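(* Let $N\ge1$ be an integer, $c>0$, $b\in(0,1)$ and $\gamma\in[0,1)$. Let $X_c$ be the set of vectors $\tilde x\in(0,\infty)^N$ with $\tilde x_1\ge\tilde x_2\ge\dots\ge\tilde x_N>0$ and $\sum_{i=1}^N\tilde x_i=c$, and let $g:X_c\to X_c$ be the mapping defined in the context (homogeneous G-AIMD dynamics under the index policy). Then the unique fixed point $\tilde x^*$ of $g$ in $X_c$ is $$\tilde x_1^*=\frac{c}{\sum_{i=1}^N\left(b^{1-\gamma}+\frac iN(1-b^{1-\gamma})\right)^{\frac1{1-\gamma}}},\qquad \tilde x_n^*=\tilde x_1^*\left[b^{1-\gamma}+\frac{N-n+1}{N}(1-b^{1-\gamma})\right]^{\frac1{1-\gamma}},\ 2\le n\le N,$$ and it is locally asymptotically stable for the iteration $\tilde x^{(m+1)}=g(\tilde x^{(m)})$ on $X_c$.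
   Context: The mapping $g=(g_1,\dots,g_N)$. For $\tilde x\in X_c$ let $k=k(\tilde x)\in\{1,\dots,N\}$ be the integer with $\tilde x_k\ge b\tilde x_1>\tilde x_{k+1}$, with the convention $\tilde x_{N+1}:=0$. Then $$g_i(\tilde x)=[\tilde x_{i+1}^{1-\gamma}+(1-\gamma)\Delta(\tilde x)]^{\frac1{1-\gamma}}\ (1\le i\le k-1),\qquad g_k(\tilde x)=[(b\tilde x_1)^{1-\gamma}+(1-\gamma)\Delta(\tilde x)]^{\frac1{1-\gamma}},$$ $$g_i(\tilde x)=[\tilde x_i^{1-\gamma}+(1-\gamma)\Delta(\tilde x)]^{\frac1{1-\gamma}}\ (k+1\le i\le N),$$ where $\Delta(\tilde x)>0$ is the number such that $\sum_{i=1}^Ng_i(\tilde x)=c$. Interpretation: $N$ users' rates evolve by $\dot x=x^\gamma$; whenever the sum of the rates reaches $c$, the largest rate is multiplied by $b$; $g$ maps the decreasingly ordered vector of rates at one such instant (before reduction) to the ordered vector at the next such instant (before reduction). Locally asymptotically stable means: for every neighbourhood $V$ of $\tilde x^*$ in $X_c$ there is a neighbourhood $W$ of $\tilde x^*$ in $X_c$ such that iterates started in $W$ remain in $V$, and there is a neighbourhood of $\tilde x^*$ in $X_c$ from which all iterates converge to $\tilde x^*$. *)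

theory Defs
  imports "HOL-Analysis.Analysis"
begin

text \<open>
  Vectors with \<open>N\<close> real entries are functions \<open>nat \<Rightarrow> real\<close> that are extensional on \<open>{1..N}\<close>.
  On such functions the topology of the function type (\<open>HOL-Analysis.Function_Topology\<close>)
  is the Euclidean topology.
\<close>

definition state_space :: "nat \<Rightarrow> real \<Rightarrow> (nat \<Rightarrow> real) set" where
  "state_space N c =
     {x \<in> {1..N} \<rightarrow>\<^sub>E {0<..}. (\<forall>i\<in>{1..<N}. x i \<ge> x (i + 1)) \<and> (\<Sum>i=1..N. x i) = c}"

definition reduced_rank :: "nat \<Rightarrow> real \<Rightarrow> (nat \<Rightarrow> real) \<Rightarrow> nat" where
  "reduced_rank N b x =
     (THE k. k \<in> {1..N} \<and> x k \<ge> b * x 1 \<and> b * x 1 > (if k = N then 0 else x (k + 1)))"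

text \<open>
  The entries after the reduction and a time \<open>d\<close> of growth, where a rate \<open>a\<close> growing
  according to \<open>x' = x powr \<gamma>\<close> reaches \<open>(a powr (1 - \<gamma>) + (1 - \<gamma>) * d) powr (1 / (1 - \<gamma>))\<close>.
\<close>

definition aimd_entry ::
    "nat \<Rightarrow> real \<Rightarrow> real \<Rightarrow> (nat \<Rightarrow> real) \<Rightarrow> real \<Rightarrow> nat \<Rightarrow> real" where
  "aimd_entry N b \<gamma> x d i =
     (let k = reduced_rank N b x in
      if i < k then (x (i + 1) powr (1 - \<gamma>) + (1 - \<gamma>) * d) powr (1 / (1 - \<gamma>))
      else if i = k then ((b * x 1) powr (1 - \<gamma>) + (1 - \<gamma>) * d) powr (1 / (1 - \<gamma>))
      else (x i powr (1 - \<gamma>) + (1 - \<gamma>) * d) powr (1 / (1 - \<gamma>)))"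

definition aimd_delta :: "nat \<Rightarrow> real \<Rightarrow> real \<Rightarrow> real \<Rightarrow> (nat \<Rightarrow> real) \<Rightarrow> real" where
  "aimd_delta N c b \<gamma> x = (THE d. d > 0 \<and> (\<Sum>i=1..N. aimd_entry N b \<gamma> x d i) = c)"

definition aimd_map ::
    "nat \<Rightarrow> real \<Rightarrow> real \<Rightarrow> real \<Rightarrow> (nat \<Rightarrow> real) \<Rightarrow> (nat \<Rightarrow> real)" where
  "aimd_map N c b \<gamma> x = (\<lambda>i\<in>{1..N}. aimd_entry N b \<gamma> x (aimd_delta N c b \<gamma> x) i)"

definition aimd_top_rate :: "nat \<Rightarrow> real \<Rightarrow> real \<Rightarrow> real \<Rightarrow> real" where
  "aimd_top_rate N c b \<gamma> =
     c / (\<Sum>i=1..N. (b powr (1 - \<gamma>) + real i / real N * (1 - b powr (1 - \<gamma>))) powr (1 / (1 - \<gamma>)))"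

definition aimd_equilibrium :: "nat \<Rightarrow> real \<Rightarrow> real \<Rightarrow> real \<Rightarrow> nat \<Rightarrow> real" where
  "aimd_equilibrium N c b \<gamma> =
     (\<lambda>n\<in>{1..N}. if n = 1 then aimd_top_rate N c b \<gamma>
        else aimd_top_rate N c b \<gamma> *
          (b powr (1 - \<gamma>) + (real N - real n + 1) / real N * (1 - b powr (1 - \<gamma>)))
            powr (1 / (1 - \<gamma>)))"

definition neighbourhood_in :: "'a::topological_space set \<Rightarrow> 'a \<Rightarrow> 'a set \<Rightarrow> bool" where
  "neighbourhood_in X p V \<longleftrightarrow>
     V \<subseteq> X \<and> (\<exists>U. openin (top_of_set X) U \<and> p \<in> U \<and> U \<subseteq> V)"

definition locally_asymptotically_stable ::
    "'a::topological_space set \<Rightarrow> ('a \<Rightarrow> 'a) \<Rightarrow> 'a \<Rightarrow> bool" where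
  "locally_asymptotically_stable X f p \<longleftrightarrow>
     (\<forall>V. neighbourhood_in X p V \<longrightarrow>
        (\<exists>W. neighbourhood_in X p W \<and> (\<forall>x\<in>W. \<forall>m. (f ^^ m) x \<in> V))) \<and>
     (\<exists>W. neighbourhood_in X p W \<and> (\<forall>x\<in>W. (\<lambda>m. (f ^^ m) x) \<longlonglongrightarrow> p))"


text \<open>The definite descriptions above are justified, and \<open>aimd_map\<close> preserves the state space.\<close>

lemma state_space_antimono:
  assumes "x \<in> state_space N c" "1 \<le> i" "i \<le> j" "j \<le> N"
  shows "x j \<le> x i"
  using assms(3,4)
proof (induction j rule: dec_induct)
  case base
  then show ?case by simp
next
  case (step n)
  then have "x (n + 1) \<le> x n"
    using assms(1,2) by (auto simp: state_space_def)
  with step show ?case by simp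
qed

lemma state_space_pos:
  assumes "x \<in> state_space N c" "i \<in> {1..N}"
  shows "x i > 0"
  using assms by (auto simp: state_space_def)

lemma ex1_reduced_rank:
  assumes x: "x \<in> state_space N c" and N: "N \<ge> 1" and b: "0 < b" "b < 1"
  shows "\<exists>!k. k \<in> {1..N} \<and> x k \<ge> b * x 1 \<and> b * x 1 > (if k = N then 0 else x (k + 1))"
proof -
  define S where "S = {k\<in>{1..N}. x k \<ge> b * x 1}"
  have pos: "x 1 > 0" using state_space_pos[OF x] N by simp
  have fin: "finite S" by (simp add: S_def)
  have one: "1 \<in> S" using b pos N by (simp add: S_def)
  define k where "k = Max S"
  have kS: "k \<in> S" unfolding k_def using fin one by (intro Max_in) auto
  have gt: "j \<notin> S" if "j > k" for j using fin that Max_ge[of S j] unfolding k_def by linarith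
  show ?thesis
  proof (rule ex1I[of _ k])
    have "b * x 1 > (if k = N then 0 else x (k + 1))"
      using gt[of "k + 1"] kS b pos by (auto simp: S_def)
    then show "k \<in> {1..N} \<and> x k \<ge> b * x 1 \<and> b * x 1 > (if k = N then 0 else x (k + 1))"
      using kS by (auto simp: S_def)
  next
    fix l assume l: "l \<in> {1..N} \<and> x l \<ge> b * x 1 \<and> b * x 1 > (if l = N then 0 else x (l + 1))"
    have "l \<le> k" using gt[of l] l by (force simp: S_def)
    moreover have "\<not> l < k"
    proof
      assume "l < k"
      then have "x k \<le> x (l + 1)" "l \<noteq> N"
        using state_space_antimono[OF x, of "l + 1" k] kS by (auto simp: S_def)
      then show False using l kS by (auto simp: S_def)
    qed
    ultimately show "l = k" by simp
  qed
qed

lemma reduced_rank: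
  assumes "x \<in> state_space N c" "N \<ge> 1" "0 < b" "b < 1"
  defines "k \<equiv> reduced_rank N b x"
  shows "k \<in> {1..N}" "x k \<ge> b * x 1" "k < N \<Longrightarrow> b * x 1 > x (k + 1)"
  using theI'[OF ex1_reduced_rank[OF assms(1-4)]]
  unfolding k_def reduced_rank_def by (auto split: if_splits)

definition reduced_entry :: "nat \<Rightarrow> real \<Rightarrow> (nat \<Rightarrow> real) \<Rightarrow> nat \<Rightarrow> real" where
  "reduced_entry N b x i =
     (let k = reduced_rank N b x in if i < k then x (i + 1) else if i = k then b * x 1 else x i)"

lemma aimd_entry_eq:
  "aimd_entry N b \<gamma> x d i =
     (reduced_entry N b x i powr (1 - \<gamma>) + (1 - \<gamma>) * d) powr (1 / (1 - \<gamma>))"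
  by (auto simp: aimd_entry_def reduced_entry_def Let_def)

lemma reduced_entry:
  assumes x: "x \<in> state_space N c" and N: "N \<ge> 1" and b: "0 < b" "b < 1"
  shows "i \<in> {1..N} \<Longrightarrow> reduced_entry N b x i > 0"
    and "i \<in> {1..<N} \<Longrightarrow> reduced_entry N b x i \<ge> reduced_entry N b x (i + 1)"
    and "(\<Sum>i=1..N. reduced_entry N b x i) < c"
proof -
  define k where "k = reduced_rank N b x"
  note k = reduced_rank[OF x N b, folded k_def]
  have r: "reduced_entry N b x i = (if i < k then x (i + 1) else if i = k then b * x 1 else x i)"
    for i by (simp add: reduced_entry_def k_def Let_def)
  have pos: "x 1 > 0" using state_space_pos[OF x] N by simp
  show "reduced_entry N b x i > 0" if "i \<in> {1..N}"
    using that state_space_pos[OF x] k(1) b pos by (auto simp: r)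
  show "reduced_entry N b x i \<ge> reduced_entry N b x (i + 1)" if i: "i \<in> {1..<N}"
  proof -
    consider "i + 1 < k" | "i + 1 = k" | "i = k" | "i > k" by linarith
    then show ?thesis
    proof cases
      case 1
      then show ?thesis using state_space_antimono[OF x, of "i + 1" "i + 2"] k(1) by (simp add: r)
    next
      case 2
      then show ?thesis using k(2) by (auto simp: r)
    next
      case 3
      then show ?thesis using k(3) i by (auto simp: r)
    next
      case 4
      then show ?thesis using state_space_antimono[OF x, of i "i + 1"] i by (simp add: r)
    qed
  qed
  have "(\<Sum>i=1..N. reduced_entry N b x i)
      = (\<Sum>i\<in>{1..<k}. x (i + 1)) + b * x 1 + (\<Sum>i\<in>{k<..N}. x i)"
  proof -
    have "{1..N} = {1..<k} \<union> {k} \<union> {k<..N}" using k(1) by auto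
    then have "(\<Sum>i=1..N. reduced_entry N b x i)
        = (\<Sum>i\<in>{1..<k} \<union> {k} \<union> {k<..N}. reduced_entry N b x i)" by simp
    also have "\<dots> = (\<Sum>i\<in>{1..<k}. reduced_entry N b x i) + reduced_entry N b x k
        + (\<Sum>i\<in>{k<..N}. reduced_entry N b x i)"
      by (subst sum.union_disjoint, simp, simp, force)+ simp
    finally show ?thesis by (simp add: r)
  qed
  also have "(\<Sum>i\<in>{1..<k}. x (i + 1)) = (\<Sum>i\<in>{1<..k}. x i)"
    by (rule sum.reindex_bij_witness[of _ "\<lambda>i. i - 1" "\<lambda>i. i + 1"]) auto
  also have "(\<Sum>i\<in>{1<..k}. x i) + b * x 1 + (\<Sum>i\<in>{k<..N}. x i) = (\<Sum>i=1..N. x i) - (1 - b) * x 1"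
  proof -
    have "{1..N} = {1} \<union> {1<..k} \<union> {k<..N}" using k(1) by auto
    then have "(\<Sum>i=1..N. x i) = (\<Sum>i\<in>{1} \<union> {1<..k} \<union> {k<..N}. x i)" by simp
    also have "\<dots> = x 1 + (\<Sum>i\<in>{1<..k}. x i) + (\<Sum>i\<in>{k<..N}. x i)"
      using k(1) by (subst sum.union_disjoint, simp, simp, force)+ simp
    finally show ?thesis by (simp add: algebra_simps)
  qed
  also have "(\<Sum>i=1..N. x i) = c" using x by (simp add: state_space_def)
  finally show "(\<Sum>i=1..N. reduced_entry N b x i) < c" using b pos by simp
qed

lemma ex1_aimd_delta:
  assumes x: "x \<in> state_space N c" and N: "N \<ge> 1" and b: "0 < b" "b < 1"
    and g: "0 \<le> \<gamma>" "\<gamma> < 1"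
  shows "\<exists>!d. d > 0 \<and> (\<Sum>i=1..N. aimd_entry N b \<gamma> x d i) = c"
proof -
  define F where "F = (\<lambda>d. \<Sum>i=1..N. aimd_entry N b \<gamma> x d i)"
  note r = reduced_entry[OF x N b]
  have ne: "{1..N} \<noteq> {}" using N by simp
  have c: "c > 0" using x N ne state_space_pos[OF x]
    by (auto simp: state_space_def intro!: sum_pos)
  have base: "reduced_entry N b x i powr (1 - \<gamma>) > 0" if "i \<in> {1..N}" for i
    using r(1)[OF that] by simp
  have mono: "F d < F e" if "0 \<le> d" "d < e" for d e
    unfolding F_def aimd_entry_eq
  proof (rule sum_strict_mono)
    fix i assume i: "i \<in> {1..N}"
    show "(reduced_entry N b x i powr (1 - \<gamma>) + (1 - \<gamma>) * d) powr (1 / (1 - \<gamma>))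
        < (reduced_entry N b x i powr (1 - \<gamma>) + (1 - \<gamma>) * e) powr (1 / (1 - \<gamma>))"
      using g that base[OF i] by (intro powr_less_mono2) (auto intro!: add_nonneg_nonneg)
  qed (use ne in auto)
  have F0: "F 0 < c"
  proof -
    have "F 0 = (\<Sum>i=1..N. reduced_entry N b x i)"
      unfolding F_def aimd_entry_eq using g less_imp_le[OF r(1)] by (intro sum.cong) (auto simp: powr_powr)
    then show ?thesis using r(3) by simp
  qed
  define D where "D = c powr (1 - \<gamma>) / (1 - \<gamma>)"
  have D: "D > 0" using c g by (simp add: D_def)
  have FD: "F D > c"
  proof -
    have i: "1 \<in> {1..N}" using N by simp
    have "c = (c powr (1 - \<gamma>)) powr (1 / (1 - \<gamma>))"
      using c g by (simp add: powr_powr)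
    also have "\<dots> < aimd_entry N b \<gamma> x D 1"
      unfolding aimd_entry_eq D_def using base[OF i] g
      by (intro powr_less_mono2) auto
    also have "\<dots> \<le> F D"
      unfolding F_def using i by (intro member_le_sum) (auto simp: aimd_entry_eq)
    finally show ?thesis .
  qed
  have cont: "continuous_on {0..D} F"
    unfolding F_def aimd_entry_eq
  proof (rule continuous_on_sum, rule continuous_on_powr)
    fix i assume i: "i \<in> {1..N}"
    show "\<forall>d\<in>{0..D}. reduced_entry N b x i powr (1 - \<gamma>) + (1 - \<gamma>) * d \<noteq> 0"
    proof
      fix d assume "d \<in> {0..D}"
      then have "reduced_entry N b x i powr (1 - \<gamma>) + (1 - \<gamma>) * d > 0"
        using base[OF i] g by (intro add_pos_nonneg) auto
      then show "reduced_entry N b x i powr (1 - \<gamma>) + (1 - \<gamma>) * d \<noteq> 0" by simp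
    qed
  qed (intro continuous_intros)+
  obtain d where d: "0 \<le> d" "d \<le> D" "F d = c"
    using IVT'[OF _ _ _ cont, of c] F0 FD D by auto
  have "d > 0" using d F0 by (cases "d = 0") auto
  show ?thesis
  proof (rule ex1I[of _ d])
    show "d > 0 \<and> (\<Sum>i=1..N. aimd_entry N b \<gamma> x d i) = c"
      using d \<open>d > 0\<close> by (simp add: F_def)
    fix e assume "e > 0 \<and> (\<Sum>i=1..N. aimd_entry N b \<gamma> x e i) = c"
    then have "e > 0" "F e = F d" using d by (auto simp: F_def)
    then show "e = d" using mono[of d e] mono[of e d] d
      by (smt (verit))
  qed
qed

lemma aimd_delta:
  assumes "x \<in> state_space N c" "N \<ge> 1" "0 < b" "b < 1" "0 \<le> \<gamma>" "\<gamma> < 1"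
  shows "aimd_delta N c b \<gamma> x > 0"
    and "(\<Sum>i=1..N. aimd_entry N b \<gamma> x (aimd_delta N c b \<gamma> x) i) = c"
  using theI'[OF ex1_aimd_delta[OF assms]] unfolding aimd_delta_def by auto

lemma aimd_map_in_state_space:
  assumes x: "x \<in> state_space N c" and N: "N \<ge> 1" and b: "0 < b" "b < 1"
    and g: "0 \<le> \<gamma>" "\<gamma> < 1"
  shows "aimd_map N c b \<gamma> x \<in> state_space N c"
proof -
  note r = reduced_entry[OF x N b] and d = aimd_delta[OF x N b g]
  let ?d = "aimd_delta N c b \<gamma> x"
  have base: "reduced_entry N b x i powr (1 - \<gamma>) + (1 - \<gamma>) * ?d > 0" if "i \<in> {1..N}" for i
    using r(1)[OF that] d(1) g by (intro add_pos_pos) auto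
  have "aimd_entry N b \<gamma> x ?d i > 0" if "i \<in> {1..N}" for i
    using base[OF that] by (simp add: aimd_entry_eq)
  moreover have "aimd_entry N b \<gamma> x ?d (i + 1) \<le> aimd_entry N b \<gamma> x ?d i" if i: "i \<in> {1..<N}" for i
    unfolding aimd_entry_eq
  proof (rule powr_mono2)
    show "0 \<le> reduced_entry N b x (i + 1) powr (1 - \<gamma>) + (1 - \<gamma>) * ?d"
      using base[of "i + 1"] i by (intro less_imp_le) auto
    show "reduced_entry N b x (i + 1) powr (1 - \<gamma>) + (1 - \<gamma>) * ?d
        \<le> reduced_entry N b x i powr (1 - \<gamma>) + (1 - \<gamma>) * ?d"
      using r(1)[of "i + 1"] r(2)[OF i] i g by (intro add_right_mono powr_mono2) auto
  qed (use g in auto)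
  ultimately show ?thesis
    using d(2) by (auto simp: state_space_def aimd_map_def)
qed

end

theory Submission
  imports Defs
begin

text \<open>
  In the levels \<open>y\<^sub>i = x\<^sub>i powr (1 - \<gamma>)\<close> growth is linear. A fixed point has reduced rank \<open>N\<close>, since
  otherwise its last entry would only grow; it is then an arithmetic progression in the levels.
  Near the equilibrium the rank is \<open>N\<close> too, so the deviations \<open>d\<close> of the levels from those of the
  equilibrium evolve by \<open>(d\<^sub>1, \<dots>, d\<^sub>N) \<mapsto> (d\<^sub>2, \<dots>, d\<^sub>N, \<beta> d\<^sub>1) + s (1, \<dots>, 1)\<close> with \<open>\<beta> = b powr (1 - \<gamma>)\<close>
  and some scalar \<open>s\<close>. As \<open>\<Sum>i. y\<^sub>i powr (1 / (1 - \<gamma>)) = c\<close> is fixed, \<open>min d \<le> 0 \<le> max d\<close>. Hence \<open>\<beta> d\<^sub>1\<close>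
  stays between \<open>min d\<close> and \<open>max d\<close>, and the spread \<open>max d - min d\<close> is a Lyapunov function. Moreover
  \<open>max d\<close> and \<open>- min d\<close> are comparable, so each new entry keeps a distance proportional to the spread
  from both ends, which makes the spread shrink by a fixed factor over every \<open>N\<close> steps.
\<close>

section \<open>Consequences of a fixed sum of powers\<close>

lemma powr_diff_bounds:
  fixes s t q :: real
  assumes "0 < t" "t \<le> s" "1 \<le> q"
  shows "s powr (q - 1) * (s - t) \<le> s powr q - t powr q"
    and "s powr q - t powr q \<le> q * s powr (q - 1) * (s - t)"
proof -
  have split: "u powr q = u powr (q - 1) * u" if "u > 0" for u :: real
    using that by (simp add: powr_diff)
  have "t powr (q - 1) * t \<le> s powr (q - 1) * t"
    using assms by (intro mult_right_mono powr_mono2) auto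
  then show "s powr (q - 1) * (s - t) \<le> s powr q - t powr q"
    using assms by (simp add: split algebra_simps)
  show "s powr q - t powr q \<le> q * s powr (q - 1) * (s - t)"
  proof (cases "t < s")
    case True
    \<comment> \<open>The mean value theorem gives the upper bound, the derivative being largest at
      \<open>s\<close>.\<close>
    have "\<exists>z>t. z < s \<and> s powr q - t powr q = (s - t) * (q * z powr (q - 1))"
      using assms(1) True
      by (intro MVT2) (auto intro!: derivative_eq_intros simp: powr_diff)
    then obtain z where z: "t < z" "z < s" "s powr q - t powr q = (s - t) * (q * z powr (q - 1))"
      by blast
    have "z powr (q - 1) \<le> s powr (q - 1)"
      using z assms by (intro powr_mono2) auto
    then have "(s - t) * (q * z powr (q - 1)) \<le> (s - t) * (q * s powr (q - 1))"
      using assms by (intro mult_left_mono) auto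
    then show ?thesis using z(3) by (simp add: mult.commute)
  qed (use assms in auto)
qed

text \<open>If \<open>u\<close> were below \<open>v\<close> everywhere, its sum would be strictly
  smaller. Used in both directions, this places 0 between the extreme deviations.\<close>

lemma exists_le_of_sum_powr_eq:
  fixes u v :: "'a \<Rightarrow> real"
  assumes "finite I" "I \<noteq> {}" "q > 0" "\<And>i. i \<in> I \<Longrightarrow> 0 < u i"
    and "(\<Sum>i\<in>I. u i powr q) = (\<Sum>i\<in>I. v i powr q)"
  shows "\<exists>i\<in>I. v i \<le> u i"
proof (rule ccontr)
  assume "\<not> ?thesis"
  then have "(\<Sum>i\<in>I. u i powr q) < (\<Sum>i\<in>I. v i powr q)"
    using assms(1-4) by (intro sum_strict_mono powr_less_mono2) (auto simp: less_imp_le not_le)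
  with assms(5) show False by simp
qed

text \<open>A deficit of \<open>u\<close> at \<open>i\<close> has to be balanced by surpluses at the
  other indices, and each surplus is at most \<open>q * R powr (q - 1) * M\<close> in the powers.
  The lower bound on the maximum matters only when \<open>u i \<le> v i\<close>, where it bounds
  \<open>v i\<close>; in this form either vector can be the fixed reference.\<close>

lemma sum_powr_eq_deviation_bound:
  fixes u v :: "'a \<Rightarrow> real"
  assumes fin: "finite I" and q: "1 \<le> q"
    and pos: "\<And>i. i \<in> I \<Longrightarrow> 0 < u i" "\<And>i. i \<in> I \<Longrightarrow> 0 < v i"
    and R: "\<And>i. i \<in> I \<Longrightarrow> u i \<le> R"
    and l: "0 < l" "\<And>i. i \<in> I \<Longrightarrow> l \<le> max (u i) (v i)"
    and sum: "(\<Sum>i\<in>I. u i powr q) = (\<Sum>i\<in>I. v i powr q)"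
    and M: "0 \<le> M" "\<And>i. i \<in> I \<Longrightarrow> u i - v i \<le> M"
    and i: "i \<in> I"
  shows "l powr (q - 1) * (v i - u i) \<le> real (card I) * (q * R powr (q - 1)) * M"
proof (cases "u i \<le> v i")
  case False
  have "l powr (q - 1) * (v i - u i) \<le> 0"
    using False by (intro mult_nonneg_nonpos) auto
  also have "0 \<le> real (card I) * (q * R powr (q - 1)) * M" using q M by simp
  finally show ?thesis .
next
  case True
  have each: "u j powr q - v j powr q \<le> q * R powr (q - 1) * M" if j: "j \<in> I" for j
  proof (cases "v j \<le> u j")
    case True
    have "u j powr q - v j powr q \<le> q * u j powr (q - 1) * (u j - v j)"
      using powr_diff_bounds(2)[OF pos(2)[OF j] True q] .
    also have "\<dots> \<le> q * R powr (q - 1) * M"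
      using True q M pos(1)[OF j] j R[OF j]
      by (intro mult_mono mult_left_mono powr_mono2) (auto simp: less_imp_le)
    finally show ?thesis .
  next
    case False
    have "u j powr q \<le> v j powr q"
      using False q pos(1)[OF j] by (intro powr_mono2) auto
    moreover have "0 \<le> q * R powr (q - 1) * M" using q M by simp
    ultimately show ?thesis by linarith
  qed
  have "l powr (q - 1) * (v i - u i) \<le> v i powr (q - 1) * (v i - u i)"
    using True l(1) l(2)[OF i] q by (intro mult_right_mono powr_mono2) auto
  also have "\<dots> \<le> v i powr q - u i powr q"
    using powr_diff_bounds(1)[OF pos(1)[OF i] True q] .
  also have "\<dots> = (\<Sum>j\<in>I - {i}. u j powr q - v j powr q)"
  proof -
    have "(\<Sum>j\<in>I. u j powr q - v j powr q) = 0" using sum by (simp add: sum_subtractf)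
    then show ?thesis using sum.remove[OF fin i, of "\<lambda>j. u j powr q - v j powr q"] by simp
  qed
  also have "\<dots> \<le> real (card (I - {i})) * (q * R powr (q - 1) * M)"
    using each by (intro sum_bounded_above) auto
  also have "\<dots> \<le> real (card I) * (q * R powr (q - 1) * M)"
    using q M fin by (intro mult_right_mono) (auto intro: card_mono)
  finally show ?thesis by (simp add: mult.assoc)
qed

section \<open>Spread of a sliding window\<close>

text \<open>Each entering value keeps a distance from both ends of its window proportional to the
  spread. After \<open>N\<close> steps the whole window consists of such values, so both ends have
  moved inwards.\<close>

lemma window_spread_tendsto_zero:
  fixes z :: "nat \<Rightarrow> real" and \<eta> :: real and N :: nat
  defines "hi \<equiv> \<lambda>m. Max (z ` {m..<m + N})" and "lo \<equiv> \<lambda>m. Min (z ` {m..<m + N})"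
  assumes N: "N \<ge> 1" and \<eta>: "\<eta> > 0"
    and upper: "\<And>m. z (m + N) \<le> hi m - \<eta> * (hi m - lo m)"
    and lower: "\<And>m. z (m + N) \<ge> lo m + \<eta> * (hi m - lo m)"
  shows "(\<lambda>m. hi m - lo m) \<longlonglongrightarrow> 0"
proof -
  have le_hi: "z i \<le> hi m" and lo_le: "lo m \<le> z i" if "i \<in> {m..<m + N}" for i m
    using that by (auto simp: hi_def lo_def)
  have hi_leI: "hi m \<le> a" if "\<And>i. i \<in> {m..<m + N} \<Longrightarrow> z i \<le> a" for m a
    using that N unfolding hi_def by (subst Max_le_iff) auto
  have lo_geI: "a \<le> lo m" if "\<And>i. i \<in> {m..<m + N} \<Longrightarrow> a \<le> z i" for m a
    using that N unfolding lo_def by (subst Min_ge_iff) auto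
  have lo_hi: "lo m \<le> hi m" for m
    using le_hi[of m m] lo_le[of m m] N by simp
  have nn: "0 \<le> \<eta> * (hi m - lo m)" for m using \<eta> lo_hi[of m] by simp
  have cases: "i \<in> {m..<m + N} \<or> i = m + N" if "i \<in> {Suc m..<Suc m + N}" for i m
    using that by auto
  have dec_hi: "decseq hi"
  proof (rule decseq_SucI, rule hi_leI)
    fix m i assume "i \<in> {Suc m..<Suc m + N}"
    then show "z i \<le> hi m" using cases[of i m] le_hi[of i m] upper[of m] nn[of m] by auto
  qed
  have inc_lo: "incseq lo"
  proof (rule incseq_SucI, rule lo_geI)
    fix m i assume "i \<in> {Suc m..<Suc m + N}"
    then show "lo m \<le> z i" using cases[of i m] lo_le[of i m] lower[of m] nn[of m] by auto
  qed
  define V where "V m = hi m - lo m" for m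
  have dec: "decseq V"
    unfolding V_def using dec_hi inc_lo by (auto simp: decseq_def incseq_def intro: diff_mono)
  have "\<forall>m. 0 \<le> V m" using lo_hi by (simp add: V_def)
  then obtain L where L: "V \<longlonglongrightarrow> L" using decseq_convergent[OF dec] by blast
  have L0: "0 \<le> L" using lo_hi by (intro LIMSEQ_le_const[OF L]) (auto simp: V_def)
  have shrink: "(1 + 2 * \<eta>) * V (m + N) \<le> V m" for m
  proof -
    have mid: "z i \<le> hi m - \<eta> * V (m + N) \<and> lo m + \<eta> * V (m + N) \<le> z i"
      if "i \<in> {m + N..<m + N + N}" for i
    proof -
      \<comment> \<open>The value \<open>z i\<close> entered from the window at \<open>n\<close>.
        That window lies within the bounds of the window at \<open>m\<close>, and its spread is at
        least the later \<open>V (m + N)\<close>.\<close>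
      define n where "n = i - N"
      have n: "i = n + N" "m \<le> n" "n \<le> m + N" using that by (auto simp: n_def)
      have "\<eta> * V (m + N) \<le> \<eta> * V n" using decseqD[OF dec n(3)] \<eta> by simp
      then show ?thesis
        using upper[of n] lower[of n] decseqD[OF dec_hi n(2)] incseqD[OF inc_lo n(2)]
        by (simp add: V_def n(1))
    qed
    have "hi (m + N) \<le> hi m - \<eta> * V (m + N)" using mid by (intro hi_leI) blast
    moreover have "lo m + \<eta> * V (m + N) \<le> lo (m + N)" using mid by (intro lo_geI) blast
    ultimately show ?thesis by (simp add: V_def algebra_simps)
  qed
  \<comment> \<open>\<open>V\<close> decreases to a limit, so the contraction only has to be read in
    the limit.\<close>
  have "(1 + 2 * \<eta>) * L \<le> L"
    using shrink by (intro LIMSEQ_le[OF tendsto_mult_left[OF LIMSEQ_ignore_initial_segment[OF L, of N]] L]) auto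
  then have "\<eta> * L \<le> 0" by (simp add: algebra_simps)
  then have "L = 0" using \<eta> L0 by (simp add: mult_le_0_iff)
  with L show ?thesis by (simp add: V_def[abs_def])
qed

section \<open>The map in level coordinates\<close>

locale aimd =
  fixes N :: nat and c b \<gamma> :: real
  assumes N: "N \<ge> 1" and c: "c > 0" and b: "0 < b" "b < 1" and g: "0 \<le> \<gamma>" "\<gamma> < 1"
begin

abbreviation "X \<equiv> state_space N c"
abbreviation "G \<equiv> aimd_map N c b \<gamma>"
abbreviation "E \<equiv> aimd_equilibrium N c b \<gamma>"
abbreviation "top_rate \<equiv> aimd_top_rate N c b \<gamma>"

definition p :: real where "p = 1 - \<gamma>"
definition \<beta> :: real where "\<beta> = b powr p"

definition level :: "(nat \<Rightarrow> real) \<Rightarrow> nat \<Rightarrow> real" where "level x i = x i powr p"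

text \<open>The factor \<open>p\<close> turns elapsed time into the increment shared by all levels,
  since a level grows linearly with slope \<open>p\<close>.\<close>

definition growth :: "(nat \<Rightarrow> real) \<Rightarrow> real" where "growth x = p * aimd_delta N c b \<gamma> x"

text \<open>Equilibrium levels relative to the first one. As \<open>shape 1 = 1\<close>, a single
  formula covers both cases of the equilibrium.\<close>

definition shape :: "nat \<Rightarrow> real" where
  "shape i = \<beta> + (real N - real i + 1) / real N * (1 - \<beta>)"

lemma p: "0 < p" "p \<le> 1" "1 / p \<ge> 1" using g by (auto simp: p_def)

lemma \<beta>: "0 < \<beta>" "\<beta> < 1"
  using b p powr_less_mono2[of p b 1] by (auto simp: \<beta>_def)

lemma level_pos: "x \<in> X \<Longrightarrow> i \<in> {1..N} \<Longrightarrow> 0 < level x i"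
  using state_space_pos[of x N c i] by (simp add: level_def)

lemma level_powr: "x \<in> X \<Longrightarrow> i \<in> {1..N} \<Longrightarrow> level x i powr (1 / p) = x i"
  using state_space_pos[of x N c i] p by (simp add: level_def powr_powr)

lemma sum_level_powr: "x \<in> X \<Longrightarrow> (\<Sum>i=1..N. level x i powr (1 / p)) = c"
proof -
  assume x: "x \<in> X"
  have "(\<Sum>i=1..N. level x i powr (1 / p)) = (\<Sum>i=1..N. x i)"
    by (intro sum.cong refl level_powr x)
  then show ?thesis using x by (simp add: state_space_def)
qed

lemma level_le: "x \<in> X \<Longrightarrow> i \<in> {1..N} \<Longrightarrow> level x i \<le> c powr p"
proof -
  assume x: "x \<in> X" and i: "i \<in> {1..N}"
  have "x i \<le> (\<Sum>i=1..N. x i)"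
    using i state_space_pos[OF x] by (intro member_le_sum) (auto simp: less_imp_le)
  then show ?thesis
    using x state_space_pos[OF x i] p by (auto simp: level_def state_space_def intro!: powr_mono2)
qed

lemma growth_pos: "x \<in> X \<Longrightarrow> 0 < growth x"
  using aimd_delta(1)[of x N c b \<gamma>] N b g p by (simp add: growth_def)

lemma map_in: "x \<in> X \<Longrightarrow> G x \<in> X"
  using aimd_map_in_state_space N b g by blast

lemma iterate_in: "x \<in> X \<Longrightarrow> (G ^^ m) x \<in> X"
  by (induction m) (auto intro: map_in)

lemma level_map:
  assumes "x \<in> X" "i \<in> {1..N}"
  shows "level (G x) i = reduced_entry N b x i powr p + growth x"
proof -
  have "0 < reduced_entry N b x i powr p + growth x"
    using growth_pos[OF assms(1)] by (intro add_nonneg_pos) auto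
  then show ?thesis
    using assms(2) p
    by (simp add: level_def aimd_map_def aimd_entry_eq p_def[symmetric] growth_def powr_powr)
qed

lemma level_map_full_rank:
  assumes x: "x \<in> X" and k: "reduced_rank N b x = N"
  shows "1 \<le> i \<Longrightarrow> i < N \<Longrightarrow> level (G x) i = level x (Suc i) + growth x"
    and "level (G x) N = \<beta> * level x 1 + growth x"
proof -
  show "level (G x) i = level x (Suc i) + growth x" if "1 \<le> i" "i < N"
    using level_map[OF x, of i] that k by (simp add: reduced_entry_def level_def)
  have "(b * x 1) powr p = \<beta> * level x 1"
    using b state_space_pos[OF x, of 1] N by (simp add: \<beta>_def level_def powr_mult)
  then show "level (G x) N = \<beta> * level x 1 + growth x"
    using level_map[OF x, of N] k N by (simp add: reduced_entry_def)
qed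

lemma full_rankI:
  assumes x: "x \<in> X" and "\<beta> * level x 1 \<le> level x N"
  shows "reduced_rank N b x = N"
proof -
  have pos: "0 < x 1" "0 < x N" using state_space_pos[OF x] N by auto
  have "(b * x 1) powr p \<le> x N powr p"
    using assms(2) b pos by (simp add: \<beta>_def level_def powr_mult)
  then have le: "b * x 1 \<le> x N"
    using powr_less_mono2[of p "x N" "b * x 1"] p pos by force
  note k = reduced_rank[OF x N b]
  show ?thesis
  \<comment> \<open>A rank \<open>k < N\<close> would give
    \<open>x (k + 1) < b * x 1 \<le> x N\<close>, against the ordering of the entries.\<close>
  proof (rule ccontr)
    assume "reduced_rank N b x \<noteq> N"
    then have "reduced_rank N b x < N" using k(1) by simp
    then show False
      using k(3) le state_space_antimono[OF x, of "reduced_rank N b x + 1" N] by force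
  qed
qed

section \<open>The equilibrium is the unique fixed point\<close>

lemma shape_one: "shape 1 = 1" using N by (simp add: shape_def)

lemma shape_pos: "i \<in> {1..N} \<Longrightarrow> 0 < shape i"
  using \<beta> N unfolding shape_def by (intro add_pos_nonneg) auto

lemma shape_step: "shape i = shape (Suc i) + (1 - \<beta>) / real N"
  using N by (simp add: shape_def field_simps)

lemma shape_last: "shape N = \<beta> + (1 - \<beta>) / real N"
  by (simp add: shape_def)

lemma equilibrium_apply: "i \<in> {1..N} \<Longrightarrow> E i = top_rate * shape i powr (1 / p)"
  using shape_one by (auto simp: aimd_equilibrium_def shape_def \<beta>_def p_def)

lemma sum_shape: "(\<Sum>i=1..N. shape i powr (1 / p)) > 0"
  "top_rate = c / (\<Sum>i=1..N. shape i powr (1 / p))"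
proof -
  show "(\<Sum>i=1..N. shape i powr (1 / p)) > 0"
    using N shape_pos by (intro sum_pos) (auto simp: less_le)
  \<comment> \<open>Reversing the summation matches the ascending index of \<open>top_rate\<close>
    with the descending one of \<open>shape\<close>.\<close>
  have "(\<Sum>i=1..N. shape i powr (1 / p)) = (\<Sum>i=1..N. shape (N + 1 - i) powr (1 / p))"
    by (subst sum.atLeastAtMost_rev) simp
  also have "\<dots> = (\<Sum>i=1..N. (\<beta> + real i / real N * (1 - \<beta>)) powr (1 / p))"
    by (intro sum.cong) (auto simp: shape_def)
  finally show "top_rate = c / (\<Sum>i=1..N. shape i powr (1 / p))"
    by (simp add: aimd_top_rate_def \<beta>_def p_def)
qed

lemma top_rate_pos: "0 < top_rate" using sum_shape c by simp

lemma equilibrium_in: "E \<in> X"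
proof -
  have "(\<Sum>i=1..N. E i) = top_rate * (\<Sum>i=1..N. shape i powr (1 / p))"
    unfolding sum_distrib_left by (intro sum.cong refl equilibrium_apply)
  then have "(\<Sum>i=1..N. E i) = c" using sum_shape by simp
  moreover have "0 < E i" if "i \<in> {1..N}" for i
    using that shape_pos[OF that] top_rate_pos by (simp add: equilibrium_apply)
  moreover have "E (i + 1) \<le> E i" if "i \<in> {1..<N}" for i
  proof -
    have "shape (Suc i) powr (1 / p) \<le> shape i powr (1 / p)"
      using that shape_pos[of "Suc i"] shape_step[of i] \<beta> p
      by (intro powr_mono2) auto
    then show ?thesis using that top_rate_pos by (simp add: equilibrium_apply)
  qed
  moreover have "E \<in> extensional {1..N}" by (simp add: aimd_equilibrium_def)
  ultimately show ?thesis by (auto simp: state_space_def PiE_def)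
qed

lemma level_equilibrium: "i \<in> {1..N} \<Longrightarrow> level E i = top_rate powr p * shape i"
  using shape_pos[of i] top_rate_pos p by (simp add: level_def equilibrium_apply powr_mult powr_powr)

text \<open>The common difference of the arithmetic progression of equilibrium levels, which turns
  out to be the growth per cycle at the equilibrium.\<close>

definition gap :: real where "gap = top_rate powr p * ((1 - \<beta>) / real N)"

lemma gap_pos: "0 < gap" using top_rate_pos \<beta> N by (simp add: gap_def)

lemma level_equilibrium_step:
  shows "1 \<le> i \<Longrightarrow> i < N \<Longrightarrow> level E i = level E (Suc i) + gap"
    and "level E N = \<beta> * level E 1 + gap"
  using N shape_step[of i] shape_last shape_one
  by (simp_all add: level_equilibrium gap_def algebra_simps)

lemma full_rank_equilibrium: "reduced_rank N b E = N"
  using full_rankI[OF equilibrium_in] level_equilibrium_step(2) gap_pos by simp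

text \<open>Reduction moves every level one place down the progression, and growth for the time
  \<open>gap / p\<close> adds \<open>gap\<close> and moves it back.\<close>

lemma aimd_entry_equilibrium:
  assumes i: "i \<in> {1..N}"
  shows "aimd_entry N b \<gamma> E (gap / p) i = E i"
proof -
  have "reduced_entry N b E i powr p + gap = level E i"
  proof (cases "i = N")
    case True
    have "(b * E 1) powr p = \<beta> * level E 1"
      using b state_space_pos[OF equilibrium_in, of 1] N by (simp add: \<beta>_def level_def powr_mult)
    then show ?thesis
      using True level_equilibrium_step(2) by (simp add: reduced_entry_def full_rank_equilibrium)
  next
    case False
    then show ?thesis
      using i level_equilibrium_step(1)[of i]
      by (simp add: reduced_entry_def full_rank_equilibrium level_def)
  qed
  then show ?thesis
    using level_powr[OF equilibrium_in i] p by (simp add: aimd_entry_eq p_def[symmetric])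
qed

lemma aimd_delta_equilibrium: "aimd_delta N c b \<gamma> E = gap / p"
  unfolding aimd_delta_def
proof (rule the1_equality[OF ex1_aimd_delta[OF equilibrium_in N b g]])
  have "(\<Sum>i=1..N. aimd_entry N b \<gamma> E (gap / p) i) = (\<Sum>i=1..N. E i)"
    by (intro sum.cong refl aimd_entry_equilibrium)
  then show "gap / p > 0 \<and> (\<Sum>i=1..N. aimd_entry N b \<gamma> E (gap / p) i) = c"
    using gap_pos p equilibrium_in by (simp add: state_space_def)
qed

lemma map_equilibrium: "G E = E"
proof
  fix i
  show "G E i = E i"
  proof (cases "i \<in> {1..N}")
    case True
    then show ?thesis
      using aimd_entry_equilibrium[OF True] by (simp add: aimd_map_def aimd_delta_equilibrium)
  next
    case False
    then show ?thesis unfolding aimd_map_def aimd_equilibrium_def by (simp only: restrict_apply if_False)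
  qed
qed

lemma fixed_point_unique:
  assumes x: "x \<in> X" and fix_x: "G x = x"
  shows "x = E"
proof -
  have k: "reduced_rank N b x = N"
  proof (rule ccontr)
    assume "reduced_rank N b x \<noteq> N"
    then have "reduced_entry N b x N = x N"
      using reduced_rank(1)[OF x N b] by (simp add: reduced_entry_def)
    then have "level x N = level x N + growth x"
      using level_map[OF x, of N] fix_x N by (simp add: level_def)
    then show False using growth_pos[OF x] by simp
  qed
  note step = level_map_full_rank[OF x k, unfolded fix_x]
  \<comment> \<open>The fixed point equations are unrolled from the last entry towards the
    first.\<close>
  have lin: "level x (N - j) = \<beta> * level x 1 + (real j + 1) * growth x" if "j < N" for j
    using that
  proof (induction j)
    case 0
    then show ?case using step(2) by simp
  next
    case (Suc j)
    then have "Suc (N - Suc j) = N - j" by simp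
    then show ?case using Suc step(1)[of "N - Suc j"] by (simp add: algebra_simps)
  qed
  \<comment> \<open>At the first entry the recursion closes up and determines the growth. Only the
    scale \<open>x 1\<close> is then free, and the sum \<open>c\<close> fixes it.\<close>
  have "level x 1 = \<beta> * level x 1 + real N * growth x"
    using lin[of "N - 1"] N by simp
  then have growth: "growth x = (1 - \<beta>) / real N * level x 1"
    using N by (simp add: field_simps)
  have lev: "level x i = level x 1 * shape i" if "i \<in> {1..N}" for i
    using lin[of "N - i"] that N by (simp add: growth shape_def field_simps)
  have x_eq: "x i = x 1 * shape i powr (1 / p)" if i: "i \<in> {1..N}" for i
  proof -
    have "x i = (level x 1 * shape i) powr (1 / p)"
      using level_powr[OF x i] lev[OF i] by simp
    also have "\<dots> = x 1 * shape i powr (1 / p)"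
      using level_pos[OF x, of 1] level_powr[OF x, of 1] shape_pos[OF i] N by (simp add: powr_mult)
    finally show ?thesis .
  qed
  have "c = (\<Sum>i=1..N. x i)" using x by (simp add: state_space_def)
  also have "\<dots> = (\<Sum>i=1..N. x 1 * shape i powr (1 / p))"
    by (intro sum.cong refl x_eq)
  also have "\<dots> = x 1 * (\<Sum>i=1..N. shape i powr (1 / p))"
    by (simp add: sum_distrib_left)
  finally have x1: "x 1 = top_rate" using sum_shape by simp
  show ?thesis
  proof
    fix i
    show "x i = E i"
    proof (cases "i \<in> {1..N}")
      case True
      then show ?thesis using x_eq[OF True] x1 equilibrium_apply[OF True] by simp
    next
      case False
      then show ?thesis using x by (auto simp: state_space_def aimd_equilibrium_def)
    qed
  qed
qed

section \<open>Deviations from the equilibrium and their spread\<close>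

definition dev :: "(nat \<Rightarrow> real) \<Rightarrow> nat \<Rightarrow> real" where "dev x i = level x i - level E i"
definition hi :: "(nat \<Rightarrow> real) \<Rightarrow> real" where "hi x = Max (dev x ` {1..N})"
definition lo :: "(nat \<Rightarrow> real) \<Rightarrow> real" where "lo x = Min (dev x ` {1..N})"

lemma dev_bounds: "i \<in> {1..N} \<Longrightarrow> dev x i \<le> hi x" "i \<in> {1..N} \<Longrightarrow> lo x \<le> dev x i"
  by (auto simp: hi_def lo_def)

lemma hi_nonneg: "x \<in> X \<Longrightarrow> 0 \<le> hi x"
proof -
  assume x: "x \<in> X"
  have "\<exists>i\<in>{1..N}. level E i \<le> level x i"
    using N p level_pos[OF x] sum_level_powr[OF x] sum_level_powr[OF equilibrium_in]
    by (intro exists_le_of_sum_powr_eq[where q = "1 / p"]) auto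
  then show ?thesis using dev_bounds(1)[of _ x] by (force simp: dev_def)
qed

lemma lo_nonpos: "x \<in> X \<Longrightarrow> lo x \<le> 0"
proof -
  assume x: "x \<in> X"
  have "\<exists>i\<in>{1..N}. level x i \<le> level E i"
    using N p level_pos[OF equilibrium_in] sum_level_powr[OF x] sum_level_powr[OF equilibrium_in]
    by (intro exists_le_of_sum_powr_eq[where q = "1 / p"]) auto
  then show ?thesis using dev_bounds(2)[of _ x] by (force simp: dev_def)
qed

text \<open>Since 0 lies between \<open>lo x\<close> and \<open>hi x\<close>, a small spread forces
  all deviations to be small; the spread thus measures the distance to \<open>E\<close>.\<close>

lemma abs_dev_le: "x \<in> X \<Longrightarrow> i \<in> {1..N} \<Longrightarrow> \<bar>dev x i\<bar> \<le> hi x - lo x"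
  using dev_bounds[of i x] hi_nonneg[of x] lo_nonpos[of x] by linarith

text \<open>The fixed sum \<open>c\<close> makes positive and negative deviations compensate each
  other. The constant is uniform on \<open>X\<close>, as all levels are at most
  \<open>c powr p\<close> and those of \<open>E\<close> are at least \<open>l\<close>.\<close>

lemma hi_lo_balanced:
  obtains K where "K > 0" "\<And>x. x \<in> X \<Longrightarrow> - lo x \<le> K * hi x" "\<And>x. x \<in> X \<Longrightarrow> hi x \<le> K * - lo x"
proof -
  define l where "l = Min (level E ` {1..N})"
  have l0: "0 < l" using N level_pos[OF equilibrium_in] unfolding l_def by (subst Min_gr_iff) auto
  have l: "l \<le> level E i" if "i \<in> {1..N}" for i using that by (auto simp: l_def)
  define C where "C = real (card {1..N}) * (1 / p * (c powr p) powr (1 / p - 1))"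
  define K where "K = C / l powr (1 / p - 1)"
  have C: "0 < C" using N p c by (simp add: C_def)
  have "- lo x \<le> K * hi x \<and> hi x \<le> K * - lo x" if x: "x \<in> X" for x
  proof -
    have sum: "(\<Sum>i=1..N. level x i powr (1 / p)) = (\<Sum>i=1..N. level E i powr (1 / p))"
      using sum_level_powr[OF x] sum_level_powr[OF equilibrium_in] by simp
    have "l powr (1 / p - 1) * (level E i - level x i) \<le> C * hi x" if i: "i \<in> {1..N}" for i
      unfolding C_def
      using p level_pos[OF x] level_pos[OF equilibrium_in] level_le[OF x] l0 l
        sum hi_nonneg[OF x] dev_bounds(1)[of _ x] i
      by (intro sum_powr_eq_deviation_bound) (auto simp: dev_def max.coboundedI2)
    then have "- dev x i \<le> K * hi x" if "i \<in> {1..N}" for i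
      using that l0 by (simp add: K_def dev_def field_simps)
    moreover have "lo x \<in> dev x ` {1..N}" unfolding lo_def using N by (intro Min_in) auto
    ultimately have 1: "- lo x \<le> K * hi x" by auto
    \<comment> \<open>The same bound with the roles of \<open>x\<close> and \<open>E\<close>
      exchanged.\<close>
    have "l powr (1 / p - 1) * (level x i - level E i) \<le> C * - lo x" if i: "i \<in> {1..N}" for i
    proof -
      have "level E j - level x j \<le> - lo x" if "j \<in> {1..N}" for j
        using dev_bounds(2)[OF that, of x] by (simp add: dev_def)
      then show ?thesis
        unfolding C_def
        using p level_pos[OF x] level_pos[OF equilibrium_in] level_le[OF equilibrium_in] l0 l
          sum[symmetric] lo_nonpos[OF x] i
        by (intro sum_powr_eq_deviation_bound) (auto simp: max.coboundedI1)
    qed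
    then have "dev x i \<le> K * - lo x" if "i \<in> {1..N}" for i
      using that l0 by (simp add: K_def dev_def field_simps)
    moreover have "hi x \<in> dev x ` {1..N}" unfolding hi_def using N by (intro Max_in) auto
    ultimately have "hi x \<le> K * - lo x" by auto
    with 1 show ?thesis by simp
  qed
  moreover have "K > 0" using C l0 by (simp add: K_def)
  ultimately show ?thesis using that by blast
qed

text \<open>At the equilibrium the last level exceeds the reduced first one by \<open>gap\<close>.
  This margin absorbs two errors of at most \<open>gap / 2\<close> each.\<close>

lemma full_rank_near:
  assumes x: "x \<in> X" and "hi x - lo x < gap / 2"
  shows "reduced_rank N b x = N"
proof (rule full_rankI[OF x])
  have d: "\<bar>dev x 1\<bar> < gap / 2" "\<bar>dev x N\<bar> < gap / 2"
    using abs_dev_le[OF x, of 1] abs_dev_le[OF x, of N] N assms(2) by auto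
  have "\<beta> * dev x 1 \<le> \<beta> * (gap / 2)" using d \<beta> by (intro mult_left_mono) auto
  also have "\<dots> \<le> 1 * (gap / 2)" using \<beta> gap_pos by (intro mult_right_mono) auto
  finally have "\<beta> * dev x 1 \<le> gap / 2" by simp
  moreover have "\<beta> * dev x 1 = \<beta> * level x 1 - \<beta> * level E 1" by (simp add: dev_def algebra_simps)
  ultimately show "\<beta> * level x 1 \<le> level x N"
    using d(2) level_equilibrium_step(2) unfolding dev_def by linarith
qed

lemma dev_map:
  assumes x: "x \<in> X" and "hi x - lo x < gap / 2"
  shows "1 \<le> i \<Longrightarrow> i < N \<Longrightarrow> dev (G x) i = dev x (Suc i) + (growth x - gap)"
    and "dev (G x) N = \<beta> * dev x 1 + (growth x - gap)"
  using level_map_full_rank[OF x full_rank_near[OF assms]] level_equilibrium_step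
  by (simp_all add: dev_def algebra_simps)

text \<open>The common shift \<open>s\<close> cancels in the spread, and the scaled entry
  \<open>\<beta> * dev x 1\<close> stays between \<open>lo x\<close> and \<open>hi x\<close> because
  0 does.\<close>

lemma spread_map_le:
  assumes x: "x \<in> X" and near: "hi x - lo x < gap / 2"
  shows "hi (G x) - lo (G x) \<le> hi x - lo x"
proof -
  define s where "s = growth x - gap"
  have d1: "dev x 1 \<le> hi x" "lo x \<le> dev x 1" using dev_bounds[of 1 x] N by auto
  have "\<beta> * dev x 1 \<le> \<beta> * hi x" "\<beta> * lo x \<le> \<beta> * dev x 1"
    using d1 \<beta> by (auto intro: mult_left_mono)
  moreover have "\<beta> * hi x \<le> hi x" "lo x \<le> \<beta> * lo x"
    using hi_nonneg[OF x] lo_nonpos[OF x] \<beta>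
    by (auto simp: mult_left_le_one_le mult_le_cancel_right1 mult_le_cancel_right2)
  ultimately have new: "\<beta> * dev x 1 \<le> hi x" "lo x \<le> \<beta> * dev x 1" by linarith+
  have "dev (G x) i \<le> hi x + s \<and> lo x + s \<le> dev (G x) i" if i: "i \<in> {1..N}" for i
  proof (cases "i = N")
    case True
    then show ?thesis using dev_map(2)[OF assms] new by (simp add: s_def)
  next
    case False
    then show ?thesis
      using dev_map(1)[OF assms, of i] i dev_bounds[of "Suc i" x] by (simp add: s_def)
  qed
  then have "hi (G x) \<le> hi x + s" "lo x + s \<le> lo (G x)"
    using N unfolding hi_def[of "G x"] lo_def[of "G x"]
    by auto
  then show ?thesis by linarith
qed

lemma spread_iterate_le:
  assumes x: "x \<in> X" and near: "hi x - lo x < gap / 2"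
  shows "hi ((G ^^ m) x) - lo ((G ^^ m) x) \<le> hi x - lo x"
proof (induction m)
  case (Suc m)
  \<comment> \<open>The spread has not grown, so the iterate is still where the one-step bound
    applies.\<close>
  then have "hi ((G ^^ m) x) - lo ((G ^^ m) x) < gap / 2" using near by linarith
  from spread_map_le[OF iterate_in[OF x] this] Suc show ?case by simp
qed simp

lemma spread_iterate_tendsto:
  assumes x: "x \<in> X" and near: "hi x - lo x < gap / 2"
  shows "(\<lambda>m. hi ((G ^^ m) x) - lo ((G ^^ m) x)) \<longlonglongrightarrow> 0"
proof -
  define y where "y m = (G ^^ m) x" for m
  have yX: "y m \<in> X" for m by (simp add: y_def iterate_in x)
  have ynear: "hi (y m) - lo (y m) < gap / 2" for m
    using spread_iterate_le[OF assms, of m] near by (simp add: y_def)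
  have ySuc: "y (Suc m) = G (y m)" for m by (simp add: y_def)
  \<comment> \<open>Up to the accumulated shifts \<open>A\<close>, the deviation vectors are the windows of one sequence \<open>z\<close>.\<close>
  define A where "A m = (\<Sum>j<m. growth (y j) - gap)" for m
  define z where "z m = dev (y m) 1 - A m" for m
  have z: "z (m + j) = dev (y m) (Suc j) - A m" if "j < N" for j m
    using that
  proof (induction j arbitrary: m)
    case (Suc j)
    then have "z (Suc m + j) = dev (y (Suc m)) (Suc j) - A (Suc m)"
      by (intro Suc.IH) simp
    then show ?case
      using dev_map(1)[OF yX ynear, of "Suc j" m] Suc.prems by (simp add: ySuc A_def)
  qed (simp add: z_def)
  \<comment> \<open>The value entering the window is the last deviation after one more step, hence
    \<open>z\<close> at \<open>Suc m\<close> with offset \<open>N - 1\<close>.\<close>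
  have z_new: "z (m + N) = \<beta> * dev (y m) 1 - A m" for m
    using z[of "N - 1" "Suc m"] N dev_map(2)[OF yX ynear, of m] by (simp add: ySuc A_def)
  have img: "z ` {m..<m + N} = (\<lambda>i. dev (y m) i + (- A m)) ` {1..N}" for m
  proof -
    have "z ` {m..<m + N} = (\<lambda>j. z (m + j)) ` {0..<N}"
      using image_image[of z "plus m" "{0..<N}"] by (simp add: add.commute)
    also have "\<dots> = (\<lambda>j. dev (y m) (Suc j) + (- A m)) ` {0..<N}"
      by (intro image_cong) (auto simp: z)
    also have "\<dots> = (\<lambda>i. dev (y m) i + (- A m)) ` Suc ` {0..<N}"
      by (simp only: image_image)
    also have "Suc ` {0..<N} = {1..N}"
      by (simp add: atLeastLessThanSuc_atLeastAtMost)
    finally show ?thesis .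
  qed
  have Max_z: "Max (z ` {m..<m + N}) = hi (y m) - A m" for m
    using N unfolding img hi_def by (subst Max_add_commute) auto
  have Min_z: "Min (z ` {m..<m + N}) = lo (y m) - A m" for m
    using N unfolding img lo_def by (subst Min_add_commute) auto
  obtain K where K: "K > 0" "\<And>x. x \<in> X \<Longrightarrow> - lo x \<le> K * hi x" "\<And>x. x \<in> X \<Longrightarrow> hi x \<le> K * - lo x"
    using hi_lo_balanced by blast
  \<comment> \<open>The scaled entry is at least \<open>(1 - \<beta>) * hi\<close> below the top and
    \<open>(1 - \<beta>) * - lo\<close> above the bottom, while the spread is at most
    \<open>1 + K\<close> times either of \<open>hi\<close> and \<open>- lo\<close>.\<close>
  define \<eta> where "\<eta> = (1 - \<beta>) / (1 + K)"
  have \<eta>: "\<eta> > 0" using \<beta> K(1) by (simp add: \<eta>_def)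
  have inner: "\<beta> * dev (y m) 1 \<le> hi (y m) - \<eta> * (hi (y m) - lo (y m))"
    "lo (y m) + \<eta> * (hi (y m) - lo (y m)) \<le> \<beta> * dev (y m) 1" for m
  proof -
    have "\<eta> * (hi (y m) - lo (y m)) \<le> \<eta> * ((1 + K) * hi (y m))"
      using K(2)[OF yX, of m] \<eta> by (intro mult_left_mono) (auto simp: algebra_simps)
    also have "\<dots> = (1 - \<beta>) * hi (y m)" using K(1) by (simp add: \<eta>_def)
    finally have 1: "\<eta> * (hi (y m) - lo (y m)) \<le> (1 - \<beta>) * hi (y m)" .
    have "\<eta> * (hi (y m) - lo (y m)) \<le> \<eta> * ((1 + K) * - lo (y m))"
      using K(3)[OF yX, of m] \<eta> by (intro mult_left_mono) (auto simp: algebra_simps)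
    also have "\<dots> = (1 - \<beta>) * - lo (y m)" using K(1) by (simp add: \<eta>_def)
    finally have 2: "\<eta> * (hi (y m) - lo (y m)) \<le> (1 - \<beta>) * - lo (y m)" .
    have "\<beta> * dev (y m) 1 \<le> \<beta> * hi (y m)" "\<beta> * lo (y m) \<le> \<beta> * dev (y m) 1"
      using dev_bounds[of 1 "y m"] N \<beta> by (auto intro: mult_left_mono)
    with 1 2 show "\<beta> * dev (y m) 1 \<le> hi (y m) - \<eta> * (hi (y m) - lo (y m))"
      "lo (y m) + \<eta> * (hi (y m) - lo (y m)) \<le> \<beta> * dev (y m) 1"
      by (simp_all add: algebra_simps)
  qed
  have "(\<lambda>m. Max (z ` {m..<m + N}) - Min (z ` {m..<m + N})) \<longlonglongrightarrow> 0"
    using inner by (intro window_spread_tendsto_zero[OF N \<eta>]) (auto simp: Max_z Min_z z_new algebra_simps)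
  then show ?thesis by (simp add: Max_z Min_z y_def)
qed

section \<open>Balls in the deviations as neighbourhoods\<close>

text \<open>An open set contains an open box around \<open>E\<close>. Continuity of
  \<open>t powr (1 / p)\<close> at each equilibrium level yields a radius per coordinate, and the
  least of these \<open>N\<close> radii serves all.\<close>

lemma dev_ball_subset:
  assumes "openin (top_of_set X) U" "E \<in> U"
  obtains \<epsilon> where "\<epsilon> > 0" "\<And>x. x \<in> X \<Longrightarrow> (\<And>i. i \<in> {1..N} \<Longrightarrow> \<bar>dev x i\<bar> < \<epsilon>) \<Longrightarrow> x \<in> U"
proof -
  obtain T where T: "open T" "U = X \<inter> T" using assms(1) by (auto simp: openin_open)
  have "openin (product_topology (\<lambda>i. euclidean) UNIV) T"
    using T(1) by (simp add: open_fun_def)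
  then obtain B where B: "E \<in> Pi\<^sub>E UNIV B" "\<And>i. open (B i)" "Pi\<^sub>E UNIV B \<subseteq> T"
    using product_topology_open_contains_basis[of "\<lambda>i. euclidean" UNIV T E] assms(2) T(2) by auto
  have "\<exists>e>0. \<forall>t. \<bar>t - level E i\<bar> < e \<longrightarrow> t powr (1 / p) \<in> B i" if i: "i \<in> {1..N}" for i
  proof -
    have "isCont (\<lambda>t. t powr (1 / p)) (level E i)"
      using level_pos[OF equilibrium_in i] by (intro continuous_intros) auto
    then have "((\<lambda>t. t powr (1 / p)) \<longlongrightarrow> E i) (at (level E i))"
      using level_powr[OF equilibrium_in i] by (simp add: isCont_def)
    then have "\<forall>\<^sub>F t in at (level E i). t powr (1 / p) \<in> B i"
      by (rule topological_tendstoD) (use B(1,2) in auto)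
    then obtain e where "e > 0" "\<And>t. t \<noteq> level E i \<Longrightarrow> dist t (level E i) < e \<Longrightarrow> t powr (1 / p) \<in> B i"
      by (auto simp: eventually_at)
    moreover have "level E i powr (1 / p) \<in> B i"
      using level_powr[OF equilibrium_in i] B(1) by auto
    ultimately show ?thesis by (metis dist_real_def)
  qed
  then obtain e where e: "\<And>i. i \<in> {1..N} \<Longrightarrow> e i > 0"
    "\<And>i t. i \<in> {1..N} \<Longrightarrow> \<bar>t - level E i\<bar> < e i \<Longrightarrow> t powr (1 / p) \<in> B i"
    by metis
  define \<epsilon> where "\<epsilon> = Min (e ` {1..N})"
  have "\<epsilon> > 0" using N e(1) unfolding \<epsilon>_def by (subst Min_gr_iff) auto
  moreover have "x \<in> U" if x: "x \<in> X" and d: "\<And>i. i \<in> {1..N} \<Longrightarrow> \<bar>dev x i\<bar> < \<epsilon>" for x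
  proof -
    have "x i \<in> B i" for i
    proof (cases "i \<in> {1..N}")
      case True
      have "\<epsilon> \<le> e i" using True by (auto simp: \<epsilon>_def)
      then show ?thesis
        using e(2)[OF True, of "level x i"] d[OF True] level_powr[OF x True] by (simp add: dev_def)
    next
      case False
      \<comment> \<open>Outside \<open>{1..N}\<close> all states are \<open>undefined\<close>, so
        these coordinates of the box impose nothing.\<close>
      then have "x i = E i" using x equilibrium_in by (auto simp: state_space_def PiE_def extensional_def)
      then show ?thesis using B(1) by auto
    qed
    then show ?thesis using B(3) T(2) x by auto
  qed
  ultimately show ?thesis using that by blast
qed

text \<open>Entries are positive on \<open>X\<close>, so levels are continuous there, and finitely
  many preimages of open intervals are intersected.\<close>

lemma neighbourhood_dev_ball:
  assumes "\<epsilon> > 0"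
  shows "neighbourhood_in X E {x \<in> X. \<forall>i\<in>{1..N}. \<bar>dev x i\<bar> < \<epsilon>}"
proof -
  have "openin (top_of_set X) (X \<inter> (\<lambda>x. dev x i) -` {-\<epsilon><..<\<epsilon>})" if i: "i \<in> {1..N}" for i
  proof (rule continuous_openin_preimage_gen)
    have "continuous_on X (\<lambda>x. x i)"
      by (rule continuous_on_subset[OF continuous_on_product_coordinates subset_UNIV])
    then show "continuous_on X (\<lambda>x. dev x i)"
      unfolding dev_def level_def
      using state_space_pos[of _ N c i] i
      by (intro continuous_on_diff continuous_on_powr continuous_on_const) force+
  qed simp
  then have "openin (top_of_set X) (\<Inter>i\<in>{1..N}. X \<inter> (\<lambda>x. dev x i) -` {-\<epsilon><..<\<epsilon>})"
    using N by (intro openin_INT2) auto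
  also have "(\<Inter>i\<in>{1..N}. X \<inter> (\<lambda>x. dev x i) -` {-\<epsilon><..<\<epsilon>}) = {x \<in> X. \<forall>i\<in>{1..N}. \<bar>dev x i\<bar> < \<epsilon>}"
    using N by (auto simp: abs_less_iff)
  finally show ?thesis
    using equilibrium_in assms by (auto simp: neighbourhood_in_def dev_def)
qed

lemma spread_less:
  assumes "\<And>i. i \<in> {1..N} \<Longrightarrow> \<bar>dev x i\<bar> < \<epsilon> / 2"
  shows "hi x - lo x < \<epsilon>"
proof -
  have "hi x \<in> dev x ` {1..N}" "lo x \<in> dev x ` {1..N}"
    unfolding hi_def lo_def using N by (auto intro!: Max_in Min_in simp del: One_nat_def)
  then have "\<bar>hi x\<bar> < \<epsilon> / 2" "\<bar>lo x\<bar> < \<epsilon> / 2" using assms by auto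
  then show ?thesis by linarith
qed

section \<open>Local asymptotic stability\<close>

lemma stable: "locally_asymptotically_stable X G E"
  unfolding locally_asymptotically_stable_def
proof (intro conjI allI impI)
  fix V assume "neighbourhood_in X E V"
  then obtain U where U: "openin (top_of_set X) U" "E \<in> U" "U \<subseteq> V"
    by (auto simp: neighbourhood_in_def)
  obtain \<epsilon> where \<epsilon>: "\<epsilon> > 0" "\<And>x. x \<in> X \<Longrightarrow> (\<And>i. i \<in> {1..N} \<Longrightarrow> \<bar>dev x i\<bar> < \<epsilon>) \<Longrightarrow> x \<in> U"
    using dev_ball_subset[OF U(1,2)] by blast
  \<comment> \<open>The spread has to be below \<open>\<epsilon>\<close> to land in \<open>U\<close>
    and below \<open>gap / 2\<close> to be nonincreasing along the orbit. Deviations below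
    \<open>r / 2\<close> ensure both.\<close>
  define r where "r = min \<epsilon> (gap / 2)"
  have r: "r > 0" using \<epsilon>(1) gap_pos by (simp add: r_def)
  have "(G ^^ m) x \<in> V" if x: "x \<in> X" and d: "\<forall>i\<in>{1..N}. \<bar>dev x i\<bar> < r / 2" for x m
  proof -
    have s: "hi x - lo x < r" using d by (intro spread_less) auto
    then have "hi ((G ^^ m) x) - lo ((G ^^ m) x) < \<epsilon>"
      using spread_iterate_le[OF x, of m] by (simp add: r_def)
    then have "(G ^^ m) x \<in> U"
      using abs_dev_le[OF iterate_in[OF x]] by (intro \<epsilon>(2) iterate_in x) (meson le_less_trans)
    then show ?thesis using U(3) by auto
  qed
  then show "\<exists>W. neighbourhood_in X E W \<and> (\<forall>x\<in>W. \<forall>m. (G ^^ m) x \<in> V)"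
    using neighbourhood_dev_ball[of "r / 2"] r
    by (intro exI[of _ "{x \<in> X. \<forall>i\<in>{1..N}. \<bar>dev x i\<bar> < r / 2}"]) auto
next
  \<comment> \<open>Deviations below \<open>gap / 4\<close> bring the spread under
    \<open>gap / 2\<close>, from where it tends to 0 and drags all deviations along.\<close>
  have "(\<lambda>m. (G ^^ m) x) \<longlonglongrightarrow> E" if x: "x \<in> X" and d: "\<forall>i\<in>{1..N}. \<bar>dev x i\<bar> < gap / 2 / 2" for x
  proof (rule topological_tendstoI)
    fix T :: "(nat \<Rightarrow> real) set" assume T: "open T" "E \<in> T"
    then have "openin (top_of_set X) (X \<inter> T)" "E \<in> X \<inter> T"
      using equilibrium_in by auto
    then obtain \<epsilon> where \<epsilon>: "\<epsilon> > 0"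
      "\<And>x. x \<in> X \<Longrightarrow> (\<And>i. i \<in> {1..N} \<Longrightarrow> \<bar>dev x i\<bar> < \<epsilon>) \<Longrightarrow> x \<in> X \<inter> T"
      using dev_ball_subset by blast
    have "hi x - lo x < gap / 2" using d by (intro spread_less) auto
    from order_tendstoD(2)[OF spread_iterate_tendsto[OF x this] \<epsilon>(1)]
    show "\<forall>\<^sub>F m in sequentially. (G ^^ m) x \<in> T"
    proof eventually_elim
      case (elim m)
      then have "(G ^^ m) x \<in> X \<inter> T"
        using abs_dev_le[OF iterate_in[OF x]] by (intro \<epsilon>(2) iterate_in x) (meson le_less_trans)
      then show ?case by simp
    qed
  qed
  then show "\<exists>W. neighbourhood_in X E W \<and> (\<forall>x\<in>W. (\<lambda>m. (G ^^ m) x) \<longlonglongrightarrow> E)"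
    using neighbourhood_dev_ball[of "gap / 2 / 2"] gap_pos
    by (intro exI[of _ "{x \<in> X. \<forall>i\<in>{1..N}. \<bar>dev x i\<bar> < gap / 2 / 2}"]) auto
qed

end

theorem mainTheorem5:
  fixes N :: nat and c b \<gamma> :: real
  assumes "N \<ge> 1" and "c > 0" and "0 < b" "b < 1" and "0 \<le> \<gamma>" "\<gamma> < 1"
  shows "{x \<in> state_space N c. aimd_map N c b \<gamma> x = x} = {aimd_equilibrium N c b \<gamma>} \<and>
         locally_asymptotically_stable (state_space N c) (aimd_map N c b \<gamma>)
           (aimd_equilibrium N c b \<gamma>)"
proof -
  interpret aimd N c b \<gamma> using assms by unfold_locales auto
  show ?thesis using fixed_point_unique equilibrium_in map_equilibrium stable by blast
qed

end
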